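(* Let $F$ be an ordered field with an integer part $I$, and let $\alpha,\beta\in F$ with $\alpha>\beta\geqslant 2$. Then $N_{\beta}\setminus N_{\alpha}\neq\emptyset$.
   Context: A subring $I$ of an ordered field $F$ is an integer part of $F$ if $I$ is discretely ordered (no $x\in I$ satisfies $0<x<1$) and for every $x\in F$ there is a (necessarily unique) $a\in I$ with $a\leqslant x<a+1$; this $a$ is denoted $\lfloor x\rfloor$. $I^{\geqslant 0}=\{x\in I: x\geqslant 0\}$. For $\alpha\in F$ positive, $N_\alpha=\{\lfloor n\alpha\rfloor : n\in I^{\geqslant 0}\}$. *)

theory Defs
  imports Main
begin

definition is_subring :: "'a::ring_1 set \<Rightarrow> bool" where
  "is_subring I \<longleftrightarrow> 1 \<in> I \<and> (\<forall>x\<in>I. \<forall>y\<in>I. x - y \<in> I \<and> x * y \<in> I)"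

definition integer_part :: "'a::linordered_field set \<Rightarrow> bool" where
  "integer_part I \<longleftrightarrow>
     is_subring I \<and>
     (\<not> (\<exists>x\<in>I. 0 < x \<and> x < 1)) \<and>
     (\<forall>x. \<exists>a\<in>I. a \<le> x \<and> x < a + 1)"

text \<open>Floor relative to \<open>I\<close>, meaningful only when \<open>I\<close> is an integer part: the element is then
  unique. The field need not be Archimedean, so the library floor does not apply.\<close>
definition ip_floor :: "'a::linordered_field set \<Rightarrow> 'a \<Rightarrow> 'a" where
  "ip_floor I x = (THE a. a \<in> I \<and> a \<le> x \<and> x < a + 1)"

text \<open>The set \<open>N\<^sub>\<alpha>\<close>, intended for positive \<open>\<alpha>\<close>.\<close>
definition beatty_set :: "'a::linordered_field set \<Rightarrow> 'a \<Rightarrow> 'a set" where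
  "beatty_set I \<alpha> = {ip_floor I (n * \<alpha>) | n. n \<in> I \<and> n \<ge> 0}"

end

theory Submission
  imports Defs
begin

text \<open>
  The idea is to find \<open>n \<in> I\<close> for which \<open>n\<beta>\<close> lies at distance at least \<open>1\<close> from every
  multiple \<open>k\<alpha>\<close> with \<open>k \<in> I\<close>: elements at distance at least \<open>1\<close> have different floors, so
  \<open>\<lfloor>n\<beta>\<rfloor> \<notin> N\<^sub>\<alpha>\<close>.

  Put \<open>\<delta> = \<alpha> - \<beta>\<close>, so that \<open>n\<beta> = n\<alpha> - n\<delta>\<close>. By discreteness, the multiples of \<open>\<alpha>\<close> next to
  \<open>n\<beta>\<close> are \<open>(n - 1)\<alpha>\<close> and \<open>n\<alpha>\<close> as soon as \<open>0 \<le> n\<delta> \<le> \<alpha>\<close>, and the required distances then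
  amount to \<open>1 \<le> n\<delta> \<le> \<alpha> - 1\<close>. As \<open>n\<close> increases by \<open>1\<close>, the gap \<open>n\<delta>\<close> increases by \<open>\<delta>\<close>, and
  the target interval has length \<open>\<alpha> - 2 \<ge> \<delta>\<close> precisely because \<open>\<beta> \<ge> 2\<close>; hence the gap cannot
  jump over it. Comparing the
  densities of \<open>N\<^sub>\<alpha>\<close> and \<open>N\<^sub>\<beta>\<close> by counting would not work here, since \<open>I\<close> need not satisfy any
  induction principle and \<open>\<delta>\<close> may be infinitesimal; instead the first \<open>n\<close> with \<open>n\<delta> > 1\<close> is
  obtained directly from the floor, as \<open>\<lfloor>1/\<delta>\<rfloor> + 1\<close>.
\<close>

lemma integer_part_add_one_le:
  assumes I: "integer_part I" and "a \<in> I" "b \<in> I" "a < b"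
  shows "a + 1 \<le> b"
proof -
  have "b - a \<in> I"
    using assms by (simp add: integer_part_def is_subring_def)
  then have "\<not> (0 < b - a \<and> b - a < 1)"
    using I unfolding integer_part_def by blast
  then show ?thesis
    using \<open>a < b\<close> by (simp add: not_less le_diff_eq add.commute)
qed

lemma integer_part_add_one_mem:
  assumes "integer_part I" and "a \<in> I"
  shows "a + 1 \<in> I"
proof -
  have one: "1 \<in> I" and diff: "\<And>x y. x \<in> I \<Longrightarrow> y \<in> I \<Longrightarrow> x - y \<in> I"
    using assms(1) by (auto simp: integer_part_def is_subring_def)
  have "a - ((1 - 1) - 1) \<in> I"
    using one diff \<open>a \<in> I\<close> by blast
  then show ?thesis by simp
qed

lemma ip_floor:
  assumes I: "integer_part I"
  shows ip_floor_mem: "ip_floor I x \<in> I"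
    and ip_floor_le: "ip_floor I x \<le> x"
    and less_ip_floor_add_one: "x < ip_floor I x + 1"
proof -
  have "\<exists>!a. a \<in> I \<and> a \<le> x \<and> x < a + 1"
  proof (rule ex_ex1I)
    show "\<exists>a. a \<in> I \<and> a \<le> x \<and> x < a + 1"
      using I unfolding integer_part_def by blast
  next
    fix a b
    assume a: "a \<in> I \<and> a \<le> x \<and> x < a + 1" and b: "b \<in> I \<and> b \<le> x \<and> x < b + 1"
    have "\<not> a < b" "\<not> b < a"
      using integer_part_add_one_le[OF I, of a b] integer_part_add_one_le[OF I, of b a] a b
      by force+
    then show "a = b" by simp
  qed
  from theI'[OF this]
  show "ip_floor I x \<in> I" "ip_floor I x \<le> x" "x < ip_floor I x + 1"
    unfolding ip_floor_def by simp_all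
qed

lemma ip_floor_less_ip_floor:
  assumes I: "integer_part I" and "x + 1 \<le> y"
  shows "ip_floor I x < ip_floor I y"
proof -
  have "ip_floor I x + 1 \<le> x + 1"
    using ip_floor_le[OF I] by simp
  also have "\<dots> \<le> y" by fact
  also have "y < ip_floor I y + 1"
    using less_ip_floor_add_one[OF I] .
  finally show ?thesis by simp
qed

theorem theorem2p3:
  fixes I :: "'a::linordered_field set" and \<alpha> \<beta> :: 'a
  assumes "integer_part I"
    and "\<alpha> > \<beta>" and "\<beta> \<ge> 2"
  shows "beatty_set I \<beta> - beatty_set I \<alpha> \<noteq> {}"
proof -
  note I = \<open>integer_part I\<close>
  define \<delta> where "\<delta> = \<alpha> - \<beta>"
  define n where "n = ip_floor I (1 / \<delta>) + 1"
  have \<delta>: "\<delta> > 0"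
    using \<open>\<alpha> > \<beta>\<close> by (simp add: \<delta>_def)
  have \<alpha>: "\<alpha> > 0"
    using \<open>\<beta> \<ge> 2\<close> \<open>\<alpha> > \<beta>\<close> by (meson less_le_trans less_trans zero_less_numeral)
  have n_mem: "n \<in> I"
    unfolding n_def using integer_part_add_one_mem[OF I ip_floor_mem[OF I]] .
  have n_gt: "1 / \<delta> < n" and n_le: "n \<le> 1 / \<delta> + 1"
    unfolding n_def using less_ip_floor_add_one[OF I] ip_floor_le[OF I] by simp_all
  have n_nonneg: "n \<ge> 0"
    using n_gt \<delta> by (meson less_imp_le less_trans zero_less_divide_1_iff)
  have gap_ge: "1 \<le> n * \<delta>"
    using n_gt \<delta> by (simp add: divide_less_eq)
  have "n * \<delta> \<le> (1 / \<delta> + 1) * \<delta>"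
    using n_le \<delta> by (simp add: mult_right_mono)
  also have "\<dots> = 1 + \<delta>"
    using \<delta> by (simp add: distrib_right)
  also have "\<dots> \<le> \<alpha> - 1"
    using \<open>\<beta> \<ge> 2\<close> by (simp add: \<delta>_def algebra_simps)
  finally have gap_le: "n * \<delta> \<le> \<alpha> - 1" .
  have n\<beta>: "n * \<beta> = n * \<alpha> - n * \<delta>"
    by (simp add: \<delta>_def algebra_simps)
  have "ip_floor I (k * \<alpha>) \<noteq> ip_floor I (n * \<beta>)" if "k \<in> I" for k
  proof (cases "k < n")
    case True
    then have "k + 1 \<le> n"
      using integer_part_add_one_le[OF I \<open>k \<in> I\<close> n_mem] by simp
    then have "(k + 1) * \<alpha> \<le> n * \<alpha>"
      using \<alpha> by (simp add: mult_right_mono)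
    then have "k * \<alpha> + 1 \<le> n * \<beta>"
      using gap_le n\<beta> by (simp add: algebra_simps)
    then show ?thesis
      using ip_floor_less_ip_floor[OF I] by force
  next
    case False
    then have "n * \<alpha> \<le> k * \<alpha>"
      using \<alpha> by (simp add: mult_right_mono)
    then have "n * \<beta> + 1 \<le> k * \<alpha>"
      using gap_ge n\<beta> by (simp add: algebra_simps)
    then show ?thesis
      using ip_floor_less_ip_floor[OF I] by force
  qed
  then have "ip_floor I (n * \<beta>) \<notin> beatty_set I \<alpha>"
    unfolding beatty_set_def by force
  moreover have "ip_floor I (n * \<beta>) \<in> beatty_set I \<beta>"
    unfolding beatty_set_def using n_mem n_nonneg by blast
  ultimately show ?thesis by blast
qed

end
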